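(* Assume that $\ell$ is convex and that the centred responses $\varepsilon_i=y_i-\mathbb{E}y_i$ are subgaussian with constant $\sigma$, i.e. $\mathbb{E}\exp(u\varepsilon_i)\le\exp(\sigma^2u^2/2)$ for all $u\in\mathbb{R}$ and $i=1,\dots,n$. Suppose that for some numbers $a_1,a_2\in(0,1)$ $$2a_1^{-2}a_2^{-1}\sigma^2\log p\;\le\;\lambda^2\;\le\;(1+a_1)^{-2}\zeta_{a_1}^2\tau^2\;<\;(1+a_1)^{-2}\zeta_{a_1}^2\,\mathring{\beta}_{min}^2/4 .$$ Then $$\mathbb{P}(\hat T_{TL}\neq T)\le 2\exp\left(-\frac{(1-a_2)a_1^2\lambda^2}{2\sigma^2}\right).$$
   Context: Model. $x_1,\dots,x_n\in\mathbb{R}^p$ are fixed, $X=[x_{.1},\dots,x_{.p}]=[x_1,\dots,x_n]^T$ is the $n\times p$ matrix with columns $x_{.j}$, normalized so that $\|x_{.j}\|=1$ for all $j$ ($\|\cdot\|$ is the Euclidean norm). The responses $y_1,\dots,y_n$ are independent real random variables, and for some true vector $\mathring{\beta}\in\mathbb{R}^p$ and a known differentiable function $\gamma:\mathbb{R}\to\mathbb{R}$ one has $\mathbb{E}y_i=\dot\gamma(x_i^T\mathring{\beta})$, $i=1,\dots,n$, where $\dot\gamma$ is the derivative of $\gamma$. Write $y=(y_1,\dots,y_n)^T$, $\varepsilon=(\varepsilon_1,\dots,\varepsilon_n)^T$, and for $\eta\in\mathbb{R}^n$ put $\vec{\dot\gamma}(\eta)=(\dot\gamma(\eta_1),\dots,\dot\gamma(\eta_n))^T$.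 Loss: $\ell(\beta)=\sum_{i=1}^n[\gamma(x_i^T\beta)-y_ix_i^T\beta]$, $\beta\in\mathbb{R}^p$. $T=\{j:\mathring{\beta}_j\ne0\}$ (nonempty), $\bar T=\{1,\dots,p\}\setminus T$, $\mathring{\beta}_{min}=\min_{j\in T}|\mathring{\beta}_j|$. For $\nu\in\mathbb{R}^p$, $\nu_J$ is the subvector with indices in $J$, $|\nu|_1=\sum_j|\nu_j|$ and $|\nu|_\infty=\max_j|\nu_j|$. For $a\in(0,1)$ define the signed pseudo-cone $$\mathcal{C}_a=\Big\{\nu\in\mathbb{R}^p:\ |\nu_{\bar T}|_1\le\tfrac{1+a}{1-a}|\nu_T|_1,\ \ \nu_jx_{.j}^T\big[\vec{\dot\gamma}(X(\mathring{\beta}+\nu))-\vec{\dot\gamma}(X\mathring{\beta})\big]\le0\ \text{ for } j\in\bar T\Big\}$$ and $$\zeta_a=\inf_{0\ne\nu\in\mathcal{C}_a}\frac{\big|X^T[\vec{\dot\gamma}(X(\mathring{\beta}+\nu))-\vec{\dot\gamma}(X\mathring{\beta})]\big|_\infty}{|\nu|_\infty}.$$ Thresholded Lasso (TL): for $\lambda>0$ and $\tau>0$, $\hat\beta$ is a Lasso estimator, $\hat\beta=\mathrm{argmin}_{\beta\in\mathbb{R}^p}\{\ell(\beta)+\lambda|\beta|_1\}$ (assumed to exist), and $\hat T_{TL}=\{j:|\hat\beta_j|>\tau\}$. *)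

theory Defs
  imports "HOL-Probability.Probability"
begin

text \<open>
  The design matrix is \<open>X :: real ^ 'p ^ 'n\<close>: its rows are the vectors \<open>x\<^sub>i\<close>, its columns
  \<open>column j X\<close> are the predictors, and \<open>(X *v \<beta>) $ i\<close> is the linear predictor of observation \<open>i\<close>.
  The supremum norm on \<open>real ^ 'p\<close> is \<open>infnorm\<close>.
\<close>

definition support :: "real ^ 'p \<Rightarrow> 'p set" where
  "support \<beta> = {j. \<beta> $ j \<noteq> 0}"

text \<open>The minimum is only meaningful for \<open>\<beta> \<noteq> 0\<close>.\<close>

definition beta_min :: "real ^ 'p::finite \<Rightarrow> real" where
  "beta_min \<beta> = (MIN j\<in>support \<beta>. \<bar>\<beta> $ j\<bar>)"

definition l1norm_on :: "'p::finite set \<Rightarrow> real ^ 'p \<Rightarrow> real" where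
  "l1norm_on J \<nu> = (\<Sum>j\<in>J. \<bar>\<nu> $ j\<bar>)"

definition vec_deriv :: "(real \<Rightarrow> real) \<Rightarrow> real ^ 'n::finite \<Rightarrow> real ^ 'n" where
  "vec_deriv \<gamma> \<eta> = (\<chi> i. deriv \<gamma> (\<eta> $ i))"

definition loss ::
  "(real \<Rightarrow> real) \<Rightarrow> real ^ 'p::finite ^ 'n::finite \<Rightarrow> real ^ 'n \<Rightarrow> real ^ 'p \<Rightarrow> real" where
  "loss \<gamma> X y \<beta> = (\<Sum>i\<in>UNIV. \<gamma> (row i X \<bullet> \<beta>) - y $ i * (row i X \<bullet> \<beta>))"

definition is_lasso ::
  "(real \<Rightarrow> real) \<Rightarrow> real ^ 'p::finite ^ 'n::finite \<Rightarrow> real ^ 'n \<Rightarrow> real \<Rightarrow> real ^ 'p \<Rightarrow> bool" where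
  "is_lasso \<gamma> X y l b \<longleftrightarrow>
     is_arg_min (\<lambda>\<beta>. loss \<gamma> X y \<beta> + l * l1norm_on UNIV \<beta>) (\<lambda>_. True) b"

definition thresholded_support :: "real \<Rightarrow> real ^ 'p \<Rightarrow> 'p set" where
  "thresholded_support \<tau> b = {j. \<bar>b $ j\<bar> > \<tau>}"

definition signed_pseudo_cone ::
  "(real \<Rightarrow> real) \<Rightarrow> real ^ 'p::finite ^ 'n::finite \<Rightarrow> real ^ 'p \<Rightarrow> real \<Rightarrow> (real ^ 'p) set" where
  "signed_pseudo_cone \<gamma> X \<beta> a =
     {\<nu>. l1norm_on (- support \<beta>) \<nu> \<le> (1 + a) / (1 - a) * l1norm_on (support \<beta>) \<nu> \<and>
         (\<forall>j\<in>- support \<beta>.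
            \<nu> $ j * (column j X \<bullet> (vec_deriv \<gamma> (X *v (\<beta> + \<nu>)) - vec_deriv \<gamma> (X *v \<beta>))) \<le> 0)}"

text \<open>
  For \<open>\<beta> \<noteq> 0\<close> and \<open>0 < a < 1\<close> the cone contains every vector supported in \<open>support \<beta>\<close>, so this is
  the infimum of a nonempty set of nonnegative reals.
\<close>

definition cone_factor ::
  "(real \<Rightarrow> real) \<Rightarrow> real ^ 'p::finite ^ 'n::finite \<Rightarrow> real ^ 'p \<Rightarrow> real \<Rightarrow> real" where
  "cone_factor \<gamma> X \<beta> a =
     (INF \<nu>\<in>signed_pseudo_cone \<gamma> X \<beta> a - {0}.
        infnorm (transpose X *v (vec_deriv \<gamma> (X *v (\<beta> + \<nu>)) - vec_deriv \<gamma> (X *v \<beta>))) / infnorm \<nu>)"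

text \<open>
  Integrability is stated explicitly because the Bochner integral of a non-integrable function
  is \<open>0\<close>, which would make the bound vacuous.
\<close>

definition subgaussian :: "'w measure \<Rightarrow> real \<Rightarrow> ('w \<Rightarrow> real) \<Rightarrow> bool" where
  "subgaussian M \<sigma> Z \<longleftrightarrow>
     (\<forall>u. integrable M (\<lambda>\<omega>. exp (u * Z \<omega>)) \<and>
          integral\<^sup>L M (\<lambda>\<omega>. exp (u * Z \<omega>)) \<le> exp (\<sigma>\<^sup>2 * u\<^sup>2 / 2))"

end

theory Submission
  imports Defs
begin

text \<open>
  Write \<open>\<nu> = betahat - \<beta>0\<close> for the estimation error, \<open>\<epsilon>\<close> for the centred response and
  \<open>d = \<gamma>'(X(\<beta>0 + \<nu>)) - \<gamma>'(X\<beta>0)\<close>, derivatives taken componentwise. The theorem separates into a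
  deterministic statement on the event that all correlations \<open>x\<^sub>j \<bullet> \<epsilon>\<close> are at most \<open>a1 * l\<close> in
  absolute value, and a bound on the probability that this event fails.

  On the event, the gradient of the loss at the Lasso has components \<open>x\<^sub>j \<bullet> d - x\<^sub>j \<bullet> \<epsilon>\<close>, and the
  optimality conditions (\<open>lasso_stationarity\<close>) say that each is at most \<open>l\<close> in size and equals
  \<open>-l\<close> times the sign of the estimated coefficient when that is nonzero. Off the support of
  \<open>\<beta>0\<close> the error is the estimate itself, so the penalty outweighs the noise and
  \<open>\<nu>\<^sub>j (x\<^sub>j \<bullet> d) \<le> -(1 - a1) l \<bar>\<nu>\<^sub>j\<bar>\<close>: this is the sign condition of the pseudo-cone. On the
  support, \<open>\<nu>\<^sub>j (x\<^sub>j \<bullet> d) \<le> (1 + a1) l \<bar>\<nu>\<^sub>j\<bar>\<close>. The sum of all these terms is \<open>(X\<nu>) \<bullet> d\<close>, which is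
  nonnegative because gradients of convex functions are monotone; this gives the \<open>\<ell>\<^sub>1\<close>
  condition (\<open>lasso_error_in_cone\<close>). The definition of the cone factor \<open>\<zeta>\<close> now turns the
  bound \<open>(1 + a1) l\<close> on the sup norm of \<open>X\<^sup>T d\<close> into
  \<open>\<zeta> \<bar>\<nu>\<bar>\<^sub>\<infinity> \<le> (1 + a1) l \<le> \<zeta> \<tau>\<close>. Hence no coordinate of the estimate is off by more than
  \<open>\<tau>\<close>, and as every true nonzero coefficient exceeds \<open>2 * \<tau>\<close> in absolute value, thresholding at \<open>\<tau>\<close>
  recovers the support exactly (\<open>thresholded_support_eq\<close>).

  Since the columns are unit vectors, each \<open>x\<^sub>j \<bullet> \<epsilon>\<close> is subgaussian with the constant \<open>\<sigma>\<close> of a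
  single centred response (\<open>subgaussian_inner\<close>). The Chernoff bound and a union bound over the \<open>p\<close>
  columns and both signs bound the failure probability by
  \<open>2 p exp(-a1\<^sup>2 l\<^sup>2 / (2 \<sigma>\<^sup>2))\<close>; the lower bound on \<open>l\<close> lets a fraction \<open>a2\<close> of the exponent
  absorb the factor \<open>p\<close>.
\<close>

section \<open>First-order conditions for the Lasso\<close>

lemma loss_has_derivative_along_line:
  fixes X :: "real ^ 'p::finite ^ 'n::finite"
  assumes diff: "\<And>t. \<gamma> differentiable (at t)"
  shows "((\<lambda>t. loss \<gamma> X y (\<beta> + t *\<^sub>R u)) has_real_derivative
           ((X *v u) \<bullet> (vec_deriv \<gamma> (X *v (\<beta> + s *\<^sub>R u)) - y))) (at s)"
proof -
  have \<gamma>': "(\<gamma> has_real_derivative deriv \<gamma> t) (at t)" for t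
    using diff[of t] DERIV_deriv_iff_real_differentiable by blast
  have row: "row i X \<bullet> w = (X *v w) $ i" for i w
    by (simp add: matrix_vector_mul_component row_def vec_nth_inverse)
  have lin: "((\<lambda>t. row i X \<bullet> (\<beta> + t *\<^sub>R u)) has_real_derivative row i X \<bullet> u) (at s)" for i
    unfolding inner_add_right inner_scaleR_right
    by (auto intro!: derivative_eq_intros)
  have "((\<lambda>t. loss \<gamma> X y (\<beta> + t *\<^sub>R u)) has_real_derivative
          (\<Sum>i\<in>UNIV. deriv \<gamma> (row i X \<bullet> (\<beta> + s *\<^sub>R u)) * (row i X \<bullet> u)
                       - y $ i * (row i X \<bullet> u))) (at s)"
    unfolding loss_def
    by (intro DERIV_sum DERIV_diff DERIV_cmult lin DERIV_chain2[OF \<gamma>'])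
  also have "(\<Sum>i\<in>UNIV. deriv \<gamma> (row i X \<bullet> (\<beta> + s *\<^sub>R u)) * (row i X \<bullet> u)
                       - y $ i * (row i X \<bullet> u))
             = (X *v u) \<bullet> (vec_deriv \<gamma> (X *v (\<beta> + s *\<^sub>R u)) - y)"
    unfolding row by (simp add: inner_vec_def vec_deriv_def algebra_simps)
  finally show ?thesis .
qed

text \<open>
  A one-variable form of the subgradient condition \<open>g \<in> - l \<partial>\<bar>b\<bar>\<close>. The bound on \<open>g\<close> holds because the
  penalty changes with slope at most \<open>l\<close> in either direction; the product form of the equality
  covers both signs of \<open>b\<close>, as well as \<open>b = 0\<close>, at once.
\<close>

lemma l1_penalized_minimum:
  fixes f :: "real \<Rightarrow> real"
  assumes f: "(f has_real_derivative g) (at 0)"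
    and min: "\<And>t. f 0 + l * \<bar>b\<bar> \<le> f t + l * \<bar>b + t\<bar>"
    and l: "l \<ge> 0"
  shows "\<bar>g\<bar> \<le> l" and "b * g = - (l * \<bar>b\<bar>)"
proof -
  have low: "f 0 \<le> f t + l * \<bar>t\<bar>" for t
    using min[of t] mult_left_mono[OF abs_triangle_ineq[of b t] l] by (simp add: distrib_left)
  have "0 \<le> l + g"
  proof (rule ccontr)
    assume "\<not> 0 \<le> l + g"
    moreover have "((\<lambda>t. f t + l * t) has_real_derivative g + l) (at 0)"
      using f by (auto intro!: derivative_eq_intros)
    ultimately obtain d where d: "d > 0" "\<And>h. 0 < h \<Longrightarrow> h < d \<Longrightarrow> f h + l * h < f 0"
      using has_real_derivative_neg_dec_right[of "\<lambda>t. f t + l * t" "g + l" 0 UNIV] by auto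
    show False using d(2)[of "d/2"] low[of "d/2"] d(1) by simp
  qed
  moreover have "0 \<le> l - g"
  proof (rule ccontr)
    assume "\<not> 0 \<le> l - g"
    moreover have "((\<lambda>t. f t - l * t) has_real_derivative g - l) (at 0)"
      using f by (auto intro!: derivative_eq_intros)
    ultimately obtain d where d: "d > 0" "\<And>h. 0 < h \<Longrightarrow> h < d \<Longrightarrow> f (- h) + l * h < f 0"
      using has_real_derivative_pos_inc_left[of "\<lambda>t. f t - l * t" "g - l" 0 UNIV] by auto
    show False using d(2)[of "d/2"] low[of "- (d/2)"] d(1) by simp
  qed
  ultimately show "\<bar>g\<bar> \<le> l" by linarith
  \<comment> \<open>Scaling \<open>b\<close> by \<open>1 + s\<close> with \<open>\<bar>s\<bar> < 1\<close> keeps its sign, so the penalty is linear in \<open>s\<close> near \<open>0\<close>.\<close>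
  have "((\<lambda>s. f (b * s) + l * ((1 + s) * \<bar>b\<bar>)) has_real_derivative b * g + l * \<bar>b\<bar>) (at 0)"
  proof -
    have "((\<lambda>s. f (b * s)) has_real_derivative g * b) (at 0)"
      using f by (intro DERIV_chain2[where g = "\<lambda>s. b * s" and f = f])
        (auto intro!: derivative_eq_intros)
    then show ?thesis by (auto intro!: derivative_eq_intros)
  qed
  moreover have "f (b * 0) + l * ((1 + 0) * \<bar>b\<bar>) \<le> f (b * s) + l * ((1 + s) * \<bar>b\<bar>)"
    if "\<bar>0 - s\<bar> < 1" for s :: real
  proof -
    have "\<bar>b + b * s\<bar> = (1 + s) * \<bar>b\<bar>"
      using that abs_mult[of "1 + s" b] by (simp add: algebra_simps)
    then show ?thesis using min[of "b * s"] by simp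
  qed
  ultimately have "b * g + l * \<bar>b\<bar> = 0"
    by (intro DERIV_local_min[where d = 1]) auto
  then show "b * g = - (l * \<bar>b\<bar>)" by simp
qed

text \<open>
  Moving a minimizer along one coordinate axis changes a single summand of the \<open>\<ell>\<^sub>1\<close> penalty, so each
  coordinate reduces to the one-variable problem.
\<close>

lemma lasso_stationarity:
  fixes X :: "real ^ 'p::finite ^ 'n::finite"
  assumes diff: "\<And>t. \<gamma> differentiable (at t)"
    and lasso: "is_lasso \<gamma> X y l b" and l: "l \<ge> 0"
  shows "\<bar>column j X \<bullet> (vec_deriv \<gamma> (X *v b) - y)\<bar> \<le> l"
    and "b $ j * (column j X \<bullet> (vec_deriv \<gamma> (X *v b) - y)) = - (l * \<bar>b $ j\<bar>)"
proof -
  let ?e = "axis j 1 :: real ^ 'p"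
  let ?f = "\<lambda>t. loss \<gamma> X y (b + t *\<^sub>R ?e)"
  have der: "(?f has_real_derivative column j X \<bullet> (vec_deriv \<gamma> (X *v b) - y)) (at 0)"
    using loss_has_derivative_along_line[OF diff, where u = ?e and s = 0]
    by (simp add: matrix_vector_mult_basis)
  have l1: "l1norm_on UNIV w = \<bar>w $ j\<bar> + l1norm_on (- {j}) w" for w :: "real ^ 'p"
    unfolding l1norm_on_def by (subst sum.remove[of _ j]) (auto simp: Compl_eq_Diff_UNIV)
  have rest: "l1norm_on (- {j}) (b + t *\<^sub>R ?e) = l1norm_on (- {j}) b" for t
    unfolding l1norm_on_def by (rule sum.cong) (auto simp: axis_def)
  have min: "?f 0 + l * \<bar>b $ j\<bar> \<le> ?f t + l * \<bar>b $ j + t\<bar>" for t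
  proof -
    have "loss \<gamma> X y b + l * l1norm_on UNIV b
            \<le> ?f t + l * l1norm_on UNIV (b + t *\<^sub>R ?e)"
      using lasso unfolding is_lasso_def is_arg_min_linorder by blast
    then show ?thesis
      unfolding l1[of b] l1[of "b + t *\<^sub>R ?e"] rest by (simp add: axis_def distrib_left)
  qed
  show "\<bar>column j X \<bullet> (vec_deriv \<gamma> (X *v b) - y)\<bar> \<le> l"
    "b $ j * (column j X \<bullet> (vec_deriv \<gamma> (X *v b) - y)) = - (l * \<bar>b $ j\<bar>)"
    using l1_penalized_minimum[OF der min l] by auto
qed

text \<open>
  Restricted to the line from \<open>\<beta>\<close> to \<open>\<beta> + \<nu>\<close>, the loss lies above its tangents at both end points;
  adding the two tangent inequalities leaves the difference of the slopes, in which the response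
  cancels.
\<close>

lemma convex_loss_gradient_monotone:
  fixes X :: "real ^ 'p::finite ^ 'n::finite"
  assumes diff: "\<And>t. \<gamma> differentiable (at t)"
    and conv: "convex_on UNIV (loss \<gamma> X y)"
  shows "0 \<le> (X *v \<nu>) \<bullet> (vec_deriv \<gamma> (X *v (\<beta> + \<nu>)) - vec_deriv \<gamma> (X *v \<beta>))"
proof -
  let ?f = "\<lambda>t. loss \<gamma> X y (\<beta> + t *\<^sub>R \<nu>)"
  have conv': "convex_on UNIV ?f"
  proof (rule convex_onI)
    fix t x z :: real assume "0 < t" "t < 1"
    have eq: "\<beta> + ((1 - t) *\<^sub>R x + t *\<^sub>R z) *\<^sub>R \<nu>
            = (1 - t) *\<^sub>R (\<beta> + x *\<^sub>R \<nu>) + t *\<^sub>R (\<beta> + z *\<^sub>R \<nu>)"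
      by (simp add: algebra_simps)
    show "?f ((1 - t) *\<^sub>R x + t *\<^sub>R z) \<le> (1 - t) * ?f x + t * ?f z"
      unfolding eq by (rule convex_onD[OF conv]) (use \<open>0 < t\<close> \<open>t < 1\<close> in auto)
  qed auto
  note der = loss_has_derivative_along_line[OF diff, where X = X and y = y and \<beta> = \<beta> and u = \<nu>]
  have der0: "(?f has_real_derivative (X *v \<nu>) \<bullet> (vec_deriv \<gamma> (X *v \<beta>) - y)) (at 0)"
    using der[where s = 0] by simp
  have der1: "(?f has_real_derivative (X *v \<nu>) \<bullet> (vec_deriv \<gamma> (X *v (\<beta> + \<nu>)) - y)) (at 1)"
    using der[where s = 1] by simp
  have "?f 1 - ?f 0 \<ge> (X *v \<nu>) \<bullet> (vec_deriv \<gamma> (X *v \<beta>) - y) * (1 - 0)"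
    by (rule convex_on_imp_above_tangent[OF conv' connected_UNIV _ _ der0]) auto
  moreover have "?f 0 - ?f 1 \<ge> (X *v \<nu>) \<bullet> (vec_deriv \<gamma> (X *v (\<beta> + \<nu>)) - y) * (0 - 1)"
    by (rule convex_on_imp_above_tangent[OF conv' connected_UNIV _ _ der1]) auto
  ultimately show ?thesis by (simp add: inner_diff_right)
qed

section \<open>The estimation error lies in the signed pseudo-cone\<close>

lemma transpose_mult_component:
  fixes X :: "real ^ 'p::finite ^ 'n::finite"
  shows "(transpose X *v d) $ j = column j X \<bullet> d"
  by (simp add: vector_matrix_mult_def column_def inner_vec_def mult.commute)

lemma inner_mult_eq_sum_columns:
  fixes X :: "real ^ 'p::finite ^ 'n::finite"
  shows "(X *v \<nu>) \<bullet> d = (\<Sum>j\<in>UNIV. \<nu> $ j * (column j X \<bullet> d))"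
  by (simp add: matrix_mult_sum inner_sum_left scalar_mult_eq_scaleR)

lemma infnorm_le_componentwise:
  fixes x :: "real ^ 'p"
  assumes "\<And>j. \<bar>x $ j\<bar> \<le> c"
  shows "infnorm x \<le> c"
  unfolding infnorm_cart using assms by (intro cSup_least) auto

text \<open>
  The gradient increment in coordinate \<open>j\<close> is the stationary gradient, of size at most \<open>l\<close>, plus
  noise of size at most \<open>a * l\<close>; this bounds its sup norm. Off the support the penalty opposes the
  error and, as \<open>a < 1\<close>, beats the noise. This yields the sign condition, and through monotonicity
  of the gradient it also limits how much of the \<open>\<ell>\<^sub>1\<close> mass of the error can sit off the support.
\<close>

lemma
  fixes X :: "real ^ 'p::finite ^ 'n::finite"
  assumes diff: "\<And>t. \<gamma> differentiable (at t)"
    and conv: "convex_on UNIV (loss \<gamma> X y)"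
    and lasso: "is_lasso \<gamma> X y l b" and l: "l > 0" and a: "a < 1"
    and noise: "\<And>j. \<bar>column j X \<bullet> (y - vec_deriv \<gamma> (X *v \<beta>))\<bar> \<le> a * l"
  shows lasso_error_in_cone: "b - \<beta> \<in> signed_pseudo_cone \<gamma> X \<beta> a"
    and lasso_gradient_increment_le:
      "infnorm (transpose X *v (vec_deriv \<gamma> (X *v b) - vec_deriv \<gamma> (X *v \<beta>))) \<le> (1 + a) * l"
proof -
  define d where "d = vec_deriv \<gamma> (X *v b) - vec_deriv \<gamma> (X *v \<beta>)"
  define g where "g = vec_deriv \<gamma> (X *v b) - y"
  define e where "e = y - vec_deriv \<gamma> (X *v \<beta>)"
  let ?\<nu> = "b - \<beta>" and ?T = "support \<beta>"
  have split: "column j X \<bullet> d = column j X \<bullet> g + column j X \<bullet> e" for j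
    by (simp add: d_def g_def e_def inner_diff_right)
  have g: "\<bar>column j X \<bullet> g\<bar> \<le> l" "b $ j * (column j X \<bullet> g) = - (l * \<bar>b $ j\<bar>)" for j
    using lasso_stationarity[OF diff lasso] l unfolding g_def by auto
  have e: "\<bar>column j X \<bullet> e\<bar> \<le> a * l" for j
    using noise unfolding e_def .
  have inc: "\<bar>column j X \<bullet> d\<bar> \<le> (1 + a) * l" for j
    using g(1)[of j] e[of j] by (simp add: split algebra_simps)
  then show "infnorm (transpose X *v (vec_deriv \<gamma> (X *v b) - vec_deriv \<gamma> (X *v \<beta>))) \<le> (1 + a) * l"
    unfolding d_def[symmetric] by (intro infnorm_le_componentwise) (simp only: transpose_mult_component)
  \<comment> \<open>On the support the sign of the error is unknown, so penalty and noise may add up.\<close>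
  have on: "?\<nu> $ j * (column j X \<bullet> d) \<le> (1 + a) * l * \<bar>?\<nu> $ j\<bar>" for j
  proof -
    have "?\<nu> $ j * (column j X \<bullet> d) \<le> \<bar>?\<nu> $ j\<bar> * \<bar>column j X \<bullet> d\<bar>"
      by (metis abs_ge_self abs_mult)
    also have "\<dots> \<le> \<bar>?\<nu> $ j\<bar> * ((1 + a) * l)" by (intro mult_left_mono inc) auto
    finally show ?thesis by (simp add: mult.commute)
  qed
  \<comment> \<open>Off the support the error has the sign of the estimate, so the penalty acts against it.\<close>
  have off: "?\<nu> $ j * (column j X \<bullet> d) \<le> - ((1 - a) * l * \<bar>?\<nu> $ j\<bar>)" if "j \<in> - ?T" for j
  proof -
    have \<nu>: "?\<nu> $ j = b $ j" using that by (simp add: support_def)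
    have "b $ j * (column j X \<bullet> e) \<le> \<bar>b $ j\<bar> * \<bar>column j X \<bullet> e\<bar>"
      by (metis abs_ge_self abs_mult)
    also have "\<dots> \<le> \<bar>b $ j\<bar> * (a * l)" by (intro mult_left_mono e) auto
    finally show ?thesis unfolding split distrib_left \<nu> g(2) by (simp add: algebra_simps)
  qed
  have "0 \<le> (X *v ?\<nu>) \<bullet> d"
    using convex_loss_gradient_monotone[OF diff conv, of ?\<nu> \<beta>] by (simp add: d_def)
  also have "\<dots> = (\<Sum>j\<in>?T. ?\<nu> $ j * (column j X \<bullet> d)) + (\<Sum>j\<in>- ?T. ?\<nu> $ j * (column j X \<bullet> d))"
    unfolding inner_mult_eq_sum_columns by (subst sum.union_disjoint[symmetric]) auto
  also have "\<dots> \<le> (\<Sum>j\<in>?T. (1 + a) * l * \<bar>?\<nu> $ j\<bar>) + (\<Sum>j\<in>- ?T. - ((1 - a) * l * \<bar>?\<nu> $ j\<bar>))"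
    using on off by (intro add_mono sum_mono)
  also have "\<dots> = l * ((1 + a) * l1norm_on ?T ?\<nu> - (1 - a) * l1norm_on (- ?T) ?\<nu>)"
    by (simp add: l1norm_on_def sum_negf sum_subtractf sum_distrib_left algebra_simps)
  finally have "(1 - a) * l1norm_on (- ?T) ?\<nu> \<le> (1 + a) * l1norm_on ?T ?\<nu>"
    using l by (simp add: zero_le_mult_iff)
  then have "l1norm_on (- ?T) ?\<nu> \<le> (1 + a) / (1 - a) * l1norm_on ?T ?\<nu>"
    using a by (simp add: field_simps)
  moreover have "?\<nu> $ j * (column j X \<bullet> d) \<le> 0" if "j \<in> - ?T" for j
    using off[OF that] a l by (smt (verit) mult_nonneg_nonneg abs_ge_zero)
  ultimately show "?\<nu> \<in> signed_pseudo_cone \<gamma> X \<beta> a"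
    by (simp add: signed_pseudo_cone_def d_def)
qed

text \<open>
  An infimum over the empty set of reals is unspecified, so the claim rests on exhibiting a nonzero
  element of the cone: \<open>\<beta>\<close> itself is one, being zero off its own support.
\<close>

lemma cone_factor_nonneg:
  fixes X :: "real ^ 'p::finite ^ 'n::finite"
  assumes "support \<beta> \<noteq> {}" "0 < a" "a < 1"
  shows "0 \<le> cone_factor \<gamma> X \<beta> a"
proof -
  have "\<beta> \<noteq> 0" using assms(1) by (auto simp: support_def)
  moreover have "\<beta> \<in> signed_pseudo_cone \<gamma> X \<beta> a"
    using assms by (auto simp: signed_pseudo_cone_def l1norm_on_def support_def
        intro!: divide_nonneg_nonneg mult_nonneg_nonneg sum_nonneg)
  ultimately have "signed_pseudo_cone \<gamma> X \<beta> a - {0} \<noteq> {}" by blast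
  then show ?thesis
    unfolding cone_factor_def by (rule cINF_greatest) (simp add: infnorm_pos_le)
qed

lemma cone_factor_times_infnorm_le:
  fixes X :: "real ^ 'p::finite ^ 'n::finite"
  assumes "\<nu> \<in> signed_pseudo_cone \<gamma> X \<beta> a"
  shows "cone_factor \<gamma> X \<beta> a * infnorm \<nu>
    \<le> infnorm (transpose X *v (vec_deriv \<gamma> (X *v (\<beta> + \<nu>)) - vec_deriv \<gamma> (X *v \<beta>)))"
proof (cases "\<nu> = 0")
  case True
  then show ?thesis by (simp add: infnorm_0)
next
  case False
  have "cone_factor \<gamma> X \<beta> a
    \<le> infnorm (transpose X *v (vec_deriv \<gamma> (X *v (\<beta> + \<nu>)) - vec_deriv \<gamma> (X *v \<beta>))) / infnorm \<nu>"
    unfolding cone_factor_def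
    by (rule cINF_lower)
      (use False assms in \<open>auto intro!: bdd_belowI2[where m = 0] simp: infnorm_pos_le\<close>)
  then show ?thesis using False by (simp add: infnorm_pos_lt pos_le_divide_eq)
qed

lemma thresholded_support_eq:
  fixes b \<beta> :: "real ^ 'p::finite"
  assumes "infnorm (b - \<beta>) \<le> \<tau>" and "2 * \<tau> < beta_min \<beta>"
  shows "thresholded_support \<tau> b = support \<beta>"
proof -
  have close: "\<bar>b $ j - \<beta> $ j\<bar> \<le> \<tau>" for j
    using component_le_infnorm_cart[of "b - \<beta>" j] assms(1) by simp
  have large: "2 * \<tau> < \<bar>\<beta> $ j\<bar>" if "j \<in> support \<beta>" for j
  proof -
    have "beta_min \<beta> \<le> \<bar>\<beta> $ j\<bar>"
      unfolding beta_min_def by (rule Min_le) (use that in auto)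
    then show ?thesis using assms(2) by linarith
  qed
  show ?thesis
  proof (intro set_eqI iffI)
    fix j assume j: "j \<in> thresholded_support \<tau> b"
    show "j \<in> support \<beta>"
      using close[of j] j by (auto simp: thresholded_support_def support_def)
  next
    fix j assume "j \<in> support \<beta>"
    then show "j \<in> thresholded_support \<tau> b"
      using close[of j] large[of j] by (simp add: thresholded_support_def)
  qed
qed

section \<open>Subgaussian linear combinations\<close>

text \<open>
  By independence the moment generating function of the linear combination factorizes, and the
  variance proxies \<open>(\<sigma> c\<^sub>i)\<^sup>2\<close> of the factors add up to \<open>(\<sigma> \<parallel>c\<parallel>)\<^sup>2\<close>.
\<close>

lemma (in prob_space) subgaussian_inner:
  fixes Z :: "'a \<Rightarrow> real ^ 'n::finite"
  assumes indep: "indep_vars (\<lambda>_. borel) (\<lambda>i \<omega>. Z \<omega> $ i) UNIV"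
    and sub: "\<And>i. subgaussian M \<sigma> (\<lambda>\<omega>. Z \<omega> $ i)"
  shows "subgaussian M (\<sigma> * norm c) (\<lambda>\<omega>. c \<bullet> Z \<omega>)"
  unfolding subgaussian_def
proof
  fix u :: real
  let ?W = "\<lambda>i \<omega>. exp (u * c $ i * Z \<omega> $ i)"
  have W: "integrable M (?W i)" "integral\<^sup>L M (?W i) \<le> exp (\<sigma>\<^sup>2 * (u * c $ i)\<^sup>2 / 2)" for i
    using sub[of i] unfolding subgaussian_def by blast+
  have indep': "indep_vars (\<lambda>_. borel) ?W UNIV"
    by (rule indep_vars_compose2[OF indep]) simp
  have eq: "exp (u * (c \<bullet> Z \<omega>)) = (\<Prod>i\<in>UNIV. ?W i \<omega>)" for \<omega>
    by (simp add: inner_vec_def exp_sum sum_distrib_left mult.assoc)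
  have "integral\<^sup>L M (\<lambda>\<omega>. exp (u * (c \<bullet> Z \<omega>))) = (\<Prod>i\<in>UNIV. integral\<^sup>L M (?W i))"
    unfolding eq by (rule indep_vars_lebesgue_integral) (use indep' W in auto)
  also have "\<dots> \<le> (\<Prod>i\<in>UNIV. exp (\<sigma>\<^sup>2 * (u * c $ i)\<^sup>2 / 2))"
    by (intro prod_mono conjI W Bochner_Integration.integral_nonneg) auto
  also have "\<dots> = exp ((\<sigma> * norm c)\<^sup>2 * u\<^sup>2 / 2)"
  proof -
    have "(norm c)\<^sup>2 = (\<Sum>i\<in>UNIV. (c $ i)\<^sup>2)"
      unfolding power2_norm_eq_inner inner_vec_def by (simp add: power2_eq_square)
    then show ?thesis
      by (simp add: exp_sum[symmetric] power_mult_distrib sum_distrib_left sum_divide_distrib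
          algebra_simps)
  qed
  finally show "integrable M (\<lambda>\<omega>. exp (u * (c \<bullet> Z \<omega>))) \<and>
      integral\<^sup>L M (\<lambda>\<omega>. exp (u * (c \<bullet> Z \<omega>))) \<le> exp ((\<sigma> * norm c)\<^sup>2 * u\<^sup>2 / 2)"
    unfolding eq using indep_vars_integrable[OF _ indep' W(1)] by simp
qed

lemma (in prob_space) subgaussian_tail:
  assumes sub: "subgaussian M \<sigma> Z" and "\<sigma> > 0" "t > 0"
  shows "prob {\<omega> \<in> space M. Z \<omega> \<ge> t} \<le> exp (- (t\<^sup>2 / (2 * \<sigma>\<^sup>2)))"
proof -
  \<comment> \<open>The minimizer of the Chernoff exponent \<open>\<sigma>\<^sup>2 u\<^sup>2 / 2 - u t\<close>.\<close>
  define u where "u = t / \<sigma>\<^sup>2"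
  have u: "u > 0" using assms by (simp add: u_def)
  have int: "integrable M (\<lambda>\<omega>. exp (u * Z \<omega>))"
    and le: "integral\<^sup>L M (\<lambda>\<omega>. exp (u * Z \<omega>)) \<le> exp (\<sigma>\<^sup>2 * u\<^sup>2 / 2)"
    using sub unfolding subgaussian_def by blast+
  have "{\<omega> \<in> space M. Z \<omega> \<ge> t} = {\<omega> \<in> space M. exp (u * Z \<omega>) \<ge> exp (u * t)}"
    using u by auto
  then have "prob {\<omega> \<in> space M. Z \<omega> \<ge> t} \<le> integral\<^sup>L M (\<lambda>\<omega>. exp (u * Z \<omega>)) / exp (u * t)"
    using integral_Markov_inequality_measure[OF int, of "{}" "exp (u * t)"] by simp
  also have "\<dots> \<le> exp (\<sigma>\<^sup>2 * u\<^sup>2 / 2) / exp (u * t)"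
    by (intro divide_right_mono le) auto
  also have "\<dots> = exp (\<sigma>\<^sup>2 * u\<^sup>2 / 2 - u * t)" by (simp add: exp_diff)
  also have "\<sigma>\<^sup>2 * u\<^sup>2 / 2 - u * t = - (t\<^sup>2 / (2 * \<sigma>\<^sup>2))"
    using assms(2) by (simp add: u_def field_simps power2_eq_square)
  finally show ?thesis .
qed

lemma (in prob_space) subgaussian_max_tail:
  fixes Z :: "'a \<Rightarrow> real ^ 'n::finite" and X :: "real ^ 'p::finite ^ 'n"
  assumes indep: "indep_vars (\<lambda>_. borel) (\<lambda>i \<omega>. Z \<omega> $ i) UNIV"
    and sub: "\<And>i. subgaussian M \<sigma> (\<lambda>\<omega>. Z \<omega> $ i)"
    and col: "\<And>j. norm (column j X) = 1" and "\<sigma> > 0" "t > 0"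
  shows "prob (\<Union>j. {\<omega> \<in> space M. \<bar>column j X \<bullet> Z \<omega>\<bar> \<ge> t})
           \<le> 2 * real CARD('p) * exp (- (t\<^sup>2 / (2 * \<sigma>\<^sup>2)))"
    and "(\<Union>j. {\<omega> \<in> space M. \<bar>column j X \<bullet> Z \<omega>\<bar> \<ge> t}) \<in> events"
proof -
  have [measurable]: "(\<lambda>\<omega>. Z \<omega> $ i) \<in> borel_measurable M" for i
    using indep unfolding indep_vars_def2 by simp
  have [measurable]: "(\<lambda>\<omega>. c \<bullet> Z \<omega>) \<in> borel_measurable M" for c
    unfolding inner_vec_def by measurable
  have one: "prob {\<omega> \<in> space M. c \<bullet> Z \<omega> \<ge> t} \<le> exp (- (t\<^sup>2 / (2 * \<sigma>\<^sup>2)))"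
    if "norm c = 1" for c
    using subgaussian_tail[OF subgaussian_inner[OF indep sub, of c]] that assms(4,5) by simp
  have two: "prob {\<omega> \<in> space M. \<bar>column j X \<bullet> Z \<omega>\<bar> \<ge> t} \<le> 2 * exp (- (t\<^sup>2 / (2 * \<sigma>\<^sup>2)))" for j
  proof -
    let ?c = "column j X"
    have "{\<omega> \<in> space M. \<bar>?c \<bullet> Z \<omega>\<bar> \<ge> t}
        = {\<omega> \<in> space M. ?c \<bullet> Z \<omega> \<ge> t} \<union> {\<omega> \<in> space M. (- ?c) \<bullet> Z \<omega> \<ge> t}" by auto
    then have "prob {\<omega> \<in> space M. \<bar>?c \<bullet> Z \<omega>\<bar> \<ge> t}
        \<le> prob {\<omega> \<in> space M. ?c \<bullet> Z \<omega> \<ge> t} + prob {\<omega> \<in> space M. (- ?c) \<bullet> Z \<omega> \<ge> t}"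
      by (simp only:) (intro measure_Un_le; measurable)
    then show ?thesis using one[of ?c] one[of "- ?c"] col[of j] by simp
  qed
  have "prob (\<Union>j. {\<omega> \<in> space M. \<bar>column j X \<bullet> Z \<omega>\<bar> \<ge> t})
        \<le> (\<Sum>j\<in>UNIV. prob {\<omega> \<in> space M. \<bar>column j X \<bullet> Z \<omega>\<bar> \<ge> t})"
    by (intro finite_measure_subadditive_finite image_subsetI; measurable)
  also have "\<dots> \<le> (\<Sum>j\<in>(UNIV::'p set). 2 * exp (- (t\<^sup>2 / (2 * \<sigma>\<^sup>2))))"
    by (intro sum_mono two)
  finally show "prob (\<Union>j. {\<omega> \<in> space M. \<bar>column j X \<bullet> Z \<omega>\<bar> \<ge> t})
           \<le> 2 * real CARD('p) * exp (- (t\<^sup>2 / (2 * \<sigma>\<^sup>2)))" by simp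
  show "(\<Union>j. {\<omega> \<in> space M. \<bar>column j X \<bullet> Z \<omega>\<bar> \<ge> t}) \<in> events" by measurable
qed

section \<open>Selection consistency of the thresholded Lasso\<close>

theorem theorem1:
  fixes M :: "'w measure"
    and X :: "real ^ 'p::finite ^ 'n::finite"
    and y :: "'w \<Rightarrow> real ^ 'n"
    and \<gamma> :: "real \<Rightarrow> real"
    and \<beta>0 :: "real ^ 'p"
    and betahat :: "'w \<Rightarrow> real ^ 'p"
    and l \<tau> \<sigma> a1 a2 :: real
  assumes "prob_space M"
    and "\<And>j. norm (column j X) = 1"
    and "\<And>t. \<gamma> differentiable (at t)"
    and "prob_space.indep_vars M (\<lambda>_. borel) (\<lambda>i \<omega>. y \<omega> $ i) UNIV"
    and "\<And>i. integrable M (\<lambda>\<omega>. y \<omega> $ i)"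
    and "\<And>i. integral\<^sup>L M (\<lambda>\<omega>. y \<omega> $ i) = deriv \<gamma> (row i X \<bullet> \<beta>0)"
    and "support \<beta>0 \<noteq> {}"
    and "\<And>\<omega>. \<omega> \<in> space M \<Longrightarrow> convex_on UNIV (loss \<gamma> X (y \<omega>))"
    and "\<sigma> > 0"
    and "\<And>i. subgaussian M \<sigma> (\<lambda>\<omega>. y \<omega> $ i - integral\<^sup>L M (\<lambda>\<omega>. y \<omega> $ i))"
    and "l > 0" and "\<tau> > 0"
    and "betahat \<in> borel_measurable M"
    and "\<And>\<omega>. \<omega> \<in> space M \<Longrightarrow> is_lasso \<gamma> X (y \<omega>) l (betahat \<omega>)"
    and "0 < a1" "a1 < 1" and "0 < a2" "a2 < 1"
    and "2 / (a1\<^sup>2 * a2) * \<sigma>\<^sup>2 * ln (real CARD('p)) \<le> l\<^sup>2"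
    and "l\<^sup>2 \<le> (cone_factor \<gamma> X \<beta>0 a1)\<^sup>2 * \<tau>\<^sup>2 / (1 + a1)\<^sup>2"
    and "(cone_factor \<gamma> X \<beta>0 a1)\<^sup>2 * \<tau>\<^sup>2 / (1 + a1)\<^sup>2
           < (cone_factor \<gamma> X \<beta>0 a1)\<^sup>2 * ((beta_min \<beta>0)\<^sup>2 / 4) / (1 + a1)\<^sup>2"
  shows "\<P>(\<omega> in M. thresholded_support \<tau> (betahat \<omega>) \<noteq> support \<beta>0)
           \<le> 2 * exp (- ((1 - a2) * a1\<^sup>2 * l\<^sup>2 / (2 * \<sigma>\<^sup>2)))"
proof -
  interpret prob_space M by fact
  let ?\<zeta> = "cone_factor \<gamma> X \<beta>0 a1"
  define Z where "Z \<omega> = y \<omega> - vec_deriv \<gamma> (X *v \<beta>0)" for \<omega>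
  define bad where "bad = (\<Union>j. {\<omega> \<in> space M. \<bar>column j X \<bullet> Z \<omega>\<bar> \<ge> a1 * l})"
  have Zi: "Z \<omega> $ i = y \<omega> $ i - integral\<^sup>L M (\<lambda>\<omega>. y \<omega> $ i)" for \<omega> i
    unfolding assms(6)
    by (simp add: Z_def vec_deriv_def matrix_vector_mul_component row_def vec_nth_inverse)
  have indep: "indep_vars (\<lambda>_. borel) (\<lambda>i \<omega>. Z \<omega> $ i) UNIV"
    unfolding Zi
    by (rule indep_vars_compose2[OF assms(4), of "\<lambda>i z. z - integral\<^sup>L M (\<lambda>\<omega>. y \<omega> $ i)"]) simp
  have sub: "subgaussian M \<sigma> (\<lambda>\<omega>. Z \<omega> $ i)" for i
    unfolding Zi by fact

  \<comment> \<open>The upper bound on \<open>\<tau>\<close> is strict after multiplication by \<open>\<zeta>\<^sup>2\<close>, which excludes \<open>\<zeta> = 0\<close>.\<close>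
  have "?\<zeta> \<noteq> 0" using assms(21) by auto
  then have \<zeta>: "?\<zeta> > 0" using cone_factor_nonneg[OF assms(7,15,16), of \<gamma> X] by linarith
  have "\<tau>\<^sup>2 < (beta_min \<beta>0 / 2)\<^sup>2"
  proof -
    have "?\<zeta>\<^sup>2 / (1 + a1)\<^sup>2 * \<tau>\<^sup>2 < ?\<zeta>\<^sup>2 / (1 + a1)\<^sup>2 * (beta_min \<beta>0 / 2)\<^sup>2"
      using assms(21) by (simp add: power_divide)
    then show ?thesis by (rule mult_left_less_imp_less) simp
  qed
  moreover have "beta_min \<beta>0 \<ge> 0"
    unfolding beta_min_def using assms(7) by (intro Min.boundedI) auto
  ultimately have bmin: "2 * \<tau> < beta_min \<beta>0"
    using power_less_imp_less_base[of \<tau> 2 "beta_min \<beta>0 / 2"] by simp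
  have "((1 + a1) * l)\<^sup>2 \<le> (?\<zeta> * \<tau>)\<^sup>2"
    using assms(20) assms(15) by (simp add: pos_le_divide_eq power_mult_distrib mult.commute)
  then have l_le: "(1 + a1) * l \<le> ?\<zeta> * \<tau>"
    by (rule power2_le_imp_le) (use \<zeta> assms(12) in simp)

  have "{\<omega> \<in> space M. thresholded_support \<tau> (betahat \<omega>) \<noteq> support \<beta>0} \<subseteq> bad"
  proof (rule ccontr)
    assume "\<not> ?thesis"
    then obtain \<omega> where \<omega>: "\<omega> \<in> space M" "\<omega> \<notin> bad"
      and ne: "thresholded_support \<tau> (betahat \<omega>) \<noteq> support \<beta>0" by blast
    have noise: "\<bar>column j X \<bullet> (y \<omega> - vec_deriv \<gamma> (X *v \<beta>0))\<bar> \<le> a1 * l" for j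
      using \<omega> by (auto simp: bad_def Z_def not_le intro: less_imp_le)
    note lasso = assms(3) assms(8)[OF \<omega>(1)] assms(14)[OF \<omega>(1)] assms(11,16) noise
    have "?\<zeta> * infnorm (betahat \<omega> - \<beta>0) \<le> (1 + a1) * l"
      using cone_factor_times_infnorm_le[OF lasso_error_in_cone[OF lasso]]
        lasso_gradient_increment_le[OF lasso] by simp
    with l_le have "?\<zeta> * infnorm (betahat \<omega> - \<beta>0) \<le> ?\<zeta> * \<tau>" by linarith
    then have "infnorm (betahat \<omega> - \<beta>0) \<le> \<tau>" using \<zeta> by simp
    from thresholded_support_eq[OF this bmin] ne show False by contradiction
  qed
  moreover have "bad \<in> events"
    unfolding bad_def
    using subgaussian_max_tail(2)[OF indep sub assms(2,9)] assms(11,15) by simp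
  ultimately have "prob {\<omega> \<in> space M. thresholded_support \<tau> (betahat \<omega>) \<noteq> support \<beta>0} \<le> prob bad"
    by (rule finite_measure_mono)
  also have "\<dots> \<le> 2 * real CARD('p) * exp (- ((a1 * l)\<^sup>2 / (2 * \<sigma>\<^sup>2)))"
    unfolding bad_def
    using subgaussian_max_tail(1)[OF indep sub assms(2,9)] assms(11,15) by simp
  also have "\<dots> = 2 * exp (ln (real CARD('p)) - (a1 * l)\<^sup>2 / (2 * \<sigma>\<^sup>2))"
    by (simp add: exp_diff exp_minus field_simps)
  also have "\<dots> \<le> 2 * exp (- ((1 - a2) * a1\<^sup>2 * l\<^sup>2 / (2 * \<sigma>\<^sup>2)))"
  proof -
    have "ln (real CARD('p)) \<le> a2 * a1\<^sup>2 * l\<^sup>2 / (2 * \<sigma>\<^sup>2)"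
      using assms(9,15,17,19) by (simp add: field_simps)
    then show ?thesis
      by (simp add: algebra_simps diff_divide_distrib power_mult_distrib)
  qed
  finally show ?thesis .
qed

end
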